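(* Let $n\ge1$, let $T\in\mathcal P_n$ be a plane tree with $n$ edges and let $\tilde T=\tilde\phi(T)$. For any node $v$ of $T$, if $v\leadsto u$ (in $T$), then $$(\mathsf{lsw},\mathsf{lev},\mathsf{rsw},\widetilde{\mathsf{rsw}})_{T}(v)=(\mathsf{lev},\mathsf{lsw},\widetilde{\mathsf{rsw}},\mathsf{rsw})_{\tilde T}(u).$$
   Context: **Plane trees.** A plane tree is a rooted tree in which the children of each node are linearly ordered (left to right). $\mathcal{P}_n$ is the set of plane trees with $n\ge1$ edges. A node without children is a leaf; otherwise it is internal. The nodes of $T\in\mathcal P_n$ are named $0,1,\dots,n$ (only to distinguish them), the root being $0$ and the leftmost child of the root being $1$. Nodes with the same parent are siblings; siblings to the left of a node are elder, those to the right are younger; the eldest child of a node is its leftmost child. **Binary trees and the involution $\tilde\phi$.** A binary tree is a rooted tree in which each node has at most one left child and at most one right child; $\mathcal{B}_n$ is the set of binary trees with $n$ nodes. The bijection $\varphi:\mathcal P_n\to\mathcal B_n$: the nodes of $\varphi(T)$ are the non-root nodes of $T$; its root is the leftmost child of the root of $T$; for non-root nodes $x,y$ of $T$, $y$ is the left child of $x$ in $\varphi(T)$ iff $y$ is the leftmost child of $x$ in $T$, and $y$ is the right child of $x$ in $\varphi(T)$ iff $x$ is the closest elder sibling of $y$ in $T$. For $B\in\mathcal B_n$, $\phi(B)$ is the mirror image of $B$ (same nodes, left and right children exchanged). Put $\tilde\phi=\varphi^{-1}\circ\phi\circ\varphi:\mathcal P_n\to\mathcal P_n$. Node names are kept,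 so $T$ and $\tilde\phi(T)$ have the same node set, both with root $0$. **Complement and the relation $\leadsto$.** Let $B=\varphi(T)$. Add new nodes to $B$ so that every node of $B$ has exactly two children; the result is the complement $\overline B$. The added nodes are named $0',1',\dots,n'$: if the added node is a left child of a node $v$ of $B$, it is named $v'$; if it is a right child of a node $v$ of $B$, it is named $u'$, where $u$ is the parent of $v$ in $T$. Define $\overline{\phi(B)}$ in the same way using $\tilde\phi(T)$ in place of $T$. For every node $v$ of $T$ there is a unique node $u$ of $T$ such that either $v'$ is the right child of $u$ in $\overline B$, or $u'$ is the right child of $v$ in $\overline{\phi(B)}$; one writes $v\leadsto u$. **Statistics of a node $v$ of a plane tree $T$.** - $\mathsf{lev}_T(v)$: number of edges on the path from $v$ to the root. - $\mathsf{Lc}_T(v)$: the set of nodes attached to nodes other than $v$ on the path from $v$ to the root from the left-hand side, i.e. the set of all elder siblings of the non-root nodes on this path ($v$ included). - $\mathsf{lsw}_T(v)$ (left spanning width): the number of children of $v$ plus $|\mathsf{Lc}_T(v)|$. - $\mathsf{rsw}_T(v)$ (right spanning width): the number of children of $v$ plus the number of edges attached to nodes other than $v$ on the path from $v$ to the root from the right-hand side (i.e. plus the total number of younger siblings of the non-root nodes on this path, $v$ included). - $\mathsf{lchain}_T(v)$: the length (number of edges) of the left chain of $v$, i.e. the path $v=v_1,v_2,\dots,v_k$ where $v_{i+1}$ is the eldest child of $v_i$ and $v_k$ is a leaf. - $\widetilde{\mathsf{deg}}_T(v)$ (dual degree): $0$ if $v$ is internal; $\mathsf{lev}_T(v)$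 if $v$ is a leaf and no node on the path from $v$ to the root has elder siblings; otherwise the number of nodes from $v$ to the first node having elder siblings (both included) when walking from $v$ to the root. - $\widetilde{\mathsf{rsw}}_T(v)=\sum_{w\in \mathsf{Lc}_T(v)\cup\mathsf{Ch}_T(v)}\mathsf{lchain}_T(w)+\widetilde{\mathsf{deg}}_T(v)$ (dual right spanning width), where $\mathsf{Ch}_T(v)$ is the set of children of $v$ in $T$. The displayed equality means equality of the four components in order. *)

theory Defs
  imports "HOL-Library.Tree"
begin

section \<open>Plane trees\<close>

datatype 'a ptree = PNode (root: 'a) (branches: "'a ptree list")

fun labels :: "'a ptree \<Rightarrow> 'a list" where
  "labels (PNode x ts) = x # concat (map labels ts)"

definition nodes :: "'a ptree \<Rightarrow> 'a set" where
  "nodes T = set (labels T)"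

text \<open>
  Plane trees with \<open>n\<close> edges whose nodes are named \<open>0, \<dots>, n\<close>. Only the names of the root and of its
  leftmost child are prescribed; all other namings are allowed.
\<close>

definition plane_trees :: "nat \<Rightarrow> nat ptree set" where
  "plane_trees n = {T. distinct (labels T) \<and> nodes T = {0..n} \<and> root T = 0 \<and>
     (\<exists>t ts. branches T = t # ts \<and> root t = 1)}"

fun psubtrees :: "'a ptree \<Rightarrow> 'a ptree set" where
  "psubtrees (PNode x ts) = insert (PNode x ts) (\<Union>t\<in>set ts. psubtrees t)"

text \<open>
  The following notions address nodes by their names, so they are meaningful for trees with
  pairwise distinct names and for nodes of the tree.
\<close>

definition subtree_at :: "'a ptree \<Rightarrow> 'a \<Rightarrow> 'a ptree" where
  "subtree_at T v = (THE s. s \<in> psubtrees T \<and> root s = v)"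

definition children :: "'a ptree \<Rightarrow> 'a \<Rightarrow> 'a list" where
  "children T v = map root (branches (subtree_at T v))"

definition parent :: "'a ptree \<Rightarrow> 'a \<Rightarrow> 'a" where
  "parent T v = (THE u. u \<in> nodes T \<and> v \<in> set (children T u))"

definition elder :: "'a ptree \<Rightarrow> 'a \<Rightarrow> 'a set" where
  "elder T v = {w. \<exists>u\<in>nodes T. \<exists>xs ys zs. children T u = xs @ w # ys @ v # zs}"

definition younger :: "'a ptree \<Rightarrow> 'a \<Rightarrow> 'a set" where
  "younger T v = {w. \<exists>u\<in>nodes T. \<exists>xs ys zs. children T u = xs @ v # ys @ w # zs}"

text \<open>Paths are listed from the node up to the root, both included.\<close>

inductive root_path :: "'a ptree \<Rightarrow> 'a list \<Rightarrow> bool" for T where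
  "root_path T [root T]"
| "root_path T (u # p) \<Longrightarrow> u \<in> nodes T \<Longrightarrow> v \<in> set (children T u) \<Longrightarrow> root_path T (v # u # p)"

definition path_to_root :: "'a ptree \<Rightarrow> 'a \<Rightarrow> 'a list" where
  "path_to_root T v = (THE p. root_path T p \<and> hd p = v)"

fun left_chain :: "'a ptree \<Rightarrow> 'a list" where
  "left_chain (PNode x []) = [x]"
| "left_chain (PNode x (t # ts)) = x # left_chain t"

section \<open>Statistics\<close>

definition lev :: "'a ptree \<Rightarrow> 'a \<Rightarrow> nat" where
  "lev T v = length (path_to_root T v) - 1"

text \<open>The root lies on every path below but contributes nothing, having no siblings.\<close>

definition Lc :: "'a ptree \<Rightarrow> 'a \<Rightarrow> 'a set" where
  "Lc T v = (\<Union>w\<in>set (path_to_root T v). elder T w)"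

definition lsw :: "'a ptree \<Rightarrow> 'a \<Rightarrow> nat" where
  "lsw T v = length (children T v) + card (Lc T v)"

definition rsw :: "'a ptree \<Rightarrow> 'a \<Rightarrow> nat" where
  "rsw T v = length (children T v) + (\<Sum>w\<in>set (path_to_root T v). card (younger T w))"

definition lchain :: "'a ptree \<Rightarrow> 'a \<Rightarrow> nat" where
  "lchain T v = length (left_chain (subtree_at T v)) - 1"

text \<open>
  The dual degree counts the nodes up to and including the first one that has elder siblings.
\<close>

definition dual_deg :: "'a ptree \<Rightarrow> 'a \<Rightarrow> nat" where
  "dual_deg T v =
     (if children T v \<noteq> [] then 0
      else if \<forall>w\<in>set (path_to_root T v). elder T w = {} then lev T v
      else length (takeWhile (\<lambda>w. elder T w = {}) (path_to_root T v)) + 1)"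

definition dual_rsw :: "'a ptree \<Rightarrow> 'a \<Rightarrow> nat" where
  "dual_rsw T v = (\<Sum>w\<in>Lc T v \<union> set (children T v). lchain T w) + dual_deg T v"

section \<open>Binary trees and the involution\<close>

definition left_child :: "'a tree \<Rightarrow> 'a \<Rightarrow> 'a \<Rightarrow> bool" where
  "left_child B x y \<longleftrightarrow> (\<exists>l r r'. \<langle>\<langle>l, y, r\<rangle>, x, r'\<rangle> \<in> subtrees B)"

definition right_child :: "'a tree \<Rightarrow> 'a \<Rightarrow> 'a \<Rightarrow> bool" where
  "right_child B x y \<longleftrightarrow> (\<exists>l' l r. \<langle>l', x, \<langle>l, y, r\<rangle>\<rangle> \<in> subtrees B)"

text \<open>Binary trees with \<open>n\<close> nodes, named \<open>1, \<dots>, n\<close>, the root being \<open>1\<close>.\<close>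

definition binary_trees :: "nat \<Rightarrow> nat tree set" where
  "binary_trees n = {B. distinct (preorder B) \<and> set_tree B = {1..n} \<and> (\<exists>l r. B = \<langle>l, 1, r\<rangle>)}"

text \<open>
  The recursive form of the bijection; its description by leftmost children and closest elder
  siblings is \<open>left_child_varphi\<close> and \<open>right_child_varphi\<close> below.
\<close>

fun varphi_forest :: "'a ptree list \<Rightarrow> 'a tree" where
  "varphi_forest [] = \<langle>\<rangle>"
| "varphi_forest (PNode x cs # ts) = \<langle>varphi_forest cs, x, varphi_forest ts\<rangle>"

definition varphi :: "'a ptree \<Rightarrow> 'a tree" where
  "varphi T = varphi_forest (branches T)"

fun forest_of :: "'a tree \<Rightarrow> 'a ptree list" where
  "forest_of \<langle>\<rangle> = []"
| "forest_of \<langle>l, x, r\<rangle> = PNode x (forest_of l) # forest_of r"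

definition varphi_inv :: "nat tree \<Rightarrow> nat ptree" where
  "varphi_inv B = PNode 0 (forest_of B)"

definition phi_tilde :: "nat ptree \<Rightarrow> nat ptree" where
  "phi_tilde T = varphi_inv (mirror (varphi T))"

section \<open>Complement and the relation \<open>\<leadsto>\<close>\<close>

text \<open>\<open>Primed v\<close> is the added node named \<open>v'\<close>.\<close>

datatype 'a cnode = Orig 'a | Primed 'a

fun complete :: "('a \<Rightarrow> 'a) \<Rightarrow> 'a tree \<Rightarrow> 'a cnode tree" where
  "complete par \<langle>\<rangle> = \<langle>\<rangle>"
| "complete par \<langle>l, v, r\<rangle> =
     \<langle>if l = \<langle>\<rangle> then \<langle>\<langle>\<rangle>, Primed v, \<langle>\<rangle>\<rangle> else complete par l,
      Orig v,
      if r = \<langle>\<rangle> then \<langle>\<langle>\<rangle>, Primed (par v), \<langle>\<rangle>\<rangle> else complete par r\<rangle>"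

text \<open>
  The complement of \<open>varphi T\<close>. The complement of its mirror image is \<open>complement (phi_tilde T)\<close>,
  since \<open>varphi (phi_tilde T) = mirror (varphi T)\<close>.
\<close>

definition complement :: "'a ptree \<Rightarrow> 'a cnode tree" where
  "complement T = complete (parent T) (varphi T)"

definition leadsto :: "nat ptree \<Rightarrow> nat \<Rightarrow> nat \<Rightarrow> bool" where
  "leadsto T v u \<longleftrightarrow> v \<in> nodes T \<and> u \<in> nodes T \<and>
     (right_child (complement T) (Orig u) (Primed v) \<or>
      right_child (complement (phi_tilde T)) (Orig v) (Primed u))"

section \<open>The notions above are well defined\<close>

lemma root_in_labels: "root T \<in> nodes T"
  by (cases T) (simp add: nodes_def)

lemma self_psubtrees [simp]: "T \<in> psubtrees T"
  by (cases T) simp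

lemma nodes_eq_root_psubtrees: "nodes T = root ` psubtrees T"
proof (induction T)
  case (PNode x ts)
  then show ?case by (auto simp: nodes_def image_UN)
qed

lemma psubtrees_trans: "s \<in> psubtrees T \<Longrightarrow> t \<in> psubtrees s \<Longrightarrow> t \<in> psubtrees T"
  by (induction T) auto

lemma branch_psubtrees: "s \<in> psubtrees T \<Longrightarrow> t \<in> set (branches s) \<Longrightarrow> t \<in> psubtrees T"
  using psubtrees_trans[of s T t] self_psubtrees[of t] by (cases s) (auto simp del: self_psubtrees)

lemma size_branch: "t \<in> set (branches s) \<Longrightarrow> size t < size s"
  by (cases s) (auto simp: less_Suc_eq_le intro: size_list_estimation')

lemma size_psubtrees: "s \<in> psubtrees T \<Longrightarrow> size s \<le> size T"
proof (induction T)
  case (PNode x ts)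
  then show ?case using size_branch[of _ "PNode x ts"] by fastforce
qed

lemma distinct_concat_mapD:
  assumes "distinct (concat (map f ts))" "s \<in> set ts" "t \<in> set ts" "x \<in> set (f s)" "x \<in> set (f t)"
  shows "s = t"
  using assms by (induction ts) auto

lemma distinct_concat_map_elem:
  "distinct (concat (map f ts)) \<Longrightarrow> s \<in> set ts \<Longrightarrow> distinct (f s)"
  by (induction ts) auto

lemma psubtrees_unique:
  "distinct (labels T) \<Longrightarrow> s \<in> psubtrees T \<Longrightarrow> s' \<in> psubtrees T \<Longrightarrow> root s = root s' \<Longrightarrow> s = s'"
proof (induction T)
  case (PNode x ts)
  have inl: "root r \<in> set (labels t)" if "r \<in> psubtrees t" for r t :: "'a ptree"
    using that nodes_eq_root_psubtrees[of t] by (auto simp: nodes_def)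
  have nx: "x \<notin> set (labels t)" if "t \<in> set ts" for t
    using PNode.prems(1) that by auto
  have d: "distinct (concat (map labels ts))" using PNode.prems(1) by simp
  consider "s = PNode x ts" "s' = PNode x ts"
    | t where "s = PNode x ts" "t \<in> set ts" "s' \<in> psubtrees t"
    | t where "s' = PNode x ts" "t \<in> set ts" "s \<in> psubtrees t"
    | t t' where "t \<in> set ts" "t' \<in> set ts" "s \<in> psubtrees t" "s' \<in> psubtrees t'"
    using PNode.prems(2,3) by auto
  then show ?case
  proof cases
    case 1 then show ?thesis by simp
  next
    case 2 then show ?thesis using inl[of s' t] nx[of t] PNode.prems(4) by auto
  next
    case 3 then show ?thesis using inl[of s t] nx[of t] PNode.prems(4) by auto
  next
    case 4
    then have "t = t'"
      using distinct_concat_mapD[OF d, of t t' "root s"] inl[of s t] inl[of s' t'] PNode.prems(4) by auto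
    then show ?thesis using 4 PNode.IH[of t] distinct_concat_map_elem[OF d] PNode.prems(4) by auto
  qed
qed

lemma ex1_subtree_at:
  assumes "distinct (labels T)" "v \<in> nodes T"
  shows "\<exists>!s. s \<in> psubtrees T \<and> root s = v"
proof -
  obtain s where "s \<in> psubtrees T" "root s = v"
    using assms(2) nodes_eq_root_psubtrees[of T] by auto
  then show ?thesis using psubtrees_unique[OF assms(1)] by (intro ex1I[of _ s]) auto
qed

lemma subtree_at_eqI:
  assumes "distinct (labels T)" "s \<in> psubtrees T"
  shows "subtree_at T (root s) = s"
  unfolding subtree_at_def by (rule the_equality) (auto intro: psubtrees_unique[OF assms(1)] assms(2))

lemma children_root:
  assumes "distinct (labels T)" "s \<in> psubtrees T"
  shows "children T (root s) = map root (branches s)"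
  by (simp add: children_def subtree_at_eqI[OF assms])

lemma children_eqE:
  assumes "distinct (labels T)" "v \<in> nodes T"
  obtains s where "s \<in> psubtrees T" "root s = v" "children T v = map root (branches s)"
  using assms children_root nodes_eq_root_psubtrees[of T] by (metis imageE)

lemma distinct_children:
  assumes "distinct (labels T)" "u \<in> nodes T"
  shows "distinct (children T u)"
proof -
  have d: "distinct (labels s)" if "s \<in> psubtrees T" for s
    using assms(1) that
  proof (induction T)
    case (PNode x ts)
    then show ?case using distinct_concat_map_elem[of labels ts] by auto
  qed
  obtain s where s: "s \<in> psubtrees T" "children T u = map root (branches s)"
    using children_eqE[OF assms] by metis
  have r: "root t \<in> set (labels t)" for t :: "'a ptree" by (cases t) simp
  have "distinct (map root ts)" if "distinct (concat (map labels ts))" for ts :: "'a ptree list"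
    using that
  proof (induction ts)
    case (Cons t ts)
    have "root t \<noteq> root t'" if "t' \<in> set ts" for t'
      using Cons.prems that r[of t] r[of t'] by auto
    then show ?case using Cons by auto
  qed simp
  then show ?thesis using d[OF s(1)] s(2) by (cases s) auto
qed

lemma children_in_nodes:
  assumes "distinct (labels T)" "u \<in> nodes T" "v \<in> set (children T u)"
  shows "v \<in> nodes T"
proof -
  obtain s where "s \<in> psubtrees T" "children T u = map root (branches s)"
    using children_eqE[OF assms(1,2)] by metis
  then show ?thesis using assms(3) branch_psubtrees nodes_eq_root_psubtrees[of T] by auto
qed

lemma psubtrees_branches_unique:
  "distinct (labels T) \<Longrightarrow> s \<in> psubtrees T \<Longrightarrow> s' \<in> psubtrees T \<Longrightarrow>
   t \<in> set (branches s) \<Longrightarrow> t \<in> set (branches s') \<Longrightarrow> s = s'"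
proof (induction T)
  case (PNode x ts)
  have inl: "root t \<in> set (labels r)" if "s \<in> psubtrees r" "t \<in> set (branches s)" for r s t :: "'a ptree"
    using branch_psubtrees[OF that] nodes_eq_root_psubtrees[of r] by (auto simp: nodes_def)
  have d: "distinct (concat (map labels ts))" using PNode.prems(1) by simp
  have self: "root t \<in> set (labels t)" for t :: "'a ptree"
    using root_in_labels[of t] by (simp add: nodes_def)
  have no: False if "t \<in> set ts" "r \<in> set ts" "s \<in> psubtrees r" "t \<in> set (branches s)" for r s
  proof -
    have "t = r"
      using distinct_concat_mapD[OF d that(1,2), of "root t"] self inl[OF that(3,4)] by simp
    then show False using size_psubtrees[OF that(3)] size_branch[OF that(4)] by simp
  qed
  consider "s = PNode x ts" "s' = PNode x ts"
    | r where "s = PNode x ts" "r \<in> set ts" "s' \<in> psubtrees r"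
    | r where "s' = PNode x ts" "r \<in> set ts" "s \<in> psubtrees r"
    | r r' where "r \<in> set ts" "r' \<in> set ts" "s \<in> psubtrees r" "s' \<in> psubtrees r'"
    using PNode.prems(2,3) by auto
  then show ?case
  proof cases
    case 1 then show ?thesis by simp
  next
    case 2 then show ?thesis using no PNode.prems by auto
  next
    case 3 then show ?thesis using no PNode.prems by auto
  next
    case 4
    then have "r = r'"
      using distinct_concat_mapD[OF d, of r r' "root t"] inl[of s r t] inl[of s' r' t] PNode.prems(4,5)
      by auto
    then show ?thesis using 4 PNode.IH[of r] distinct_concat_map_elem[OF d] PNode.prems(4,5) by auto
  qed
qed

lemma parent_unique:
  assumes d: "distinct (labels T)" and "u \<in> nodes T" "u' \<in> nodes T"
    and v: "v \<in> set (children T u)" "v \<in> set (children T u')"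
  shows "u = u'"
proof -
  obtain s where s: "s \<in> psubtrees T" "root s = u" "children T u = map root (branches s)"
    using children_eqE[OF d assms(2)] .
  obtain s' where s': "s' \<in> psubtrees T" "root s' = u'" "children T u' = map root (branches s')"
    using children_eqE[OF d assms(3)] .
  obtain t t' where "t \<in> set (branches s)" "t' \<in> set (branches s')" "root t = v" "root t' = v"
    using v s(3) s'(3) by auto
  then show ?thesis
    using psubtrees_branches_unique[OF d] psubtrees_unique[OF d] branch_psubtrees s s' by metis
qed

lemma parent_eqI:
  assumes "distinct (labels T)" "u \<in> nodes T" "v \<in> set (children T u)"
  shows "parent T v = u"
  unfolding parent_def by (rule the_equality) (auto intro: parent_unique[OF assms(1)] assms(2,3))

lemma root_notin_children:
  assumes d: "distinct (labels T)" and "u \<in> nodes T"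
  shows "root T \<notin> set (children T u)"
proof
  assume "root T \<in> set (children T u)"
  then obtain s t where s: "s \<in> psubtrees T" "t \<in> set (branches s)" "root t = root T"
    using children_eqE[OF d assms(2)] by (metis imageE list.set_map)
  then have "t = T" using psubtrees_unique[OF d] branch_psubtrees self_psubtrees by metis
  then show False using size_psubtrees[OF s(1)] size_branch[OF s(2)] by simp
qed

lemma root_path_nonempty: "root_path T p \<Longrightarrow> p \<noteq> []"
  by (cases rule: root_path.cases) auto

lemma root_path_unique:
  assumes d: "distinct (labels T)"
  shows "root_path T p \<Longrightarrow> root_path T q \<Longrightarrow> hd p = hd q \<Longrightarrow> p = q"
proof (induction arbitrary: q rule: root_path.induct)
  case 1
  from 1(1) show ?case
    by (cases rule: root_path.cases) (use 1(2) root_notin_children[OF d] in auto)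
next
  case (2 u p v)
  from 2(5) show ?case
  proof (cases rule: root_path.cases)
    case 1
    then show ?thesis using 2 root_notin_children[OF d] by auto
  next
    case (2 u' p' v')
    then have "u' = u" using parent_unique[OF d] \<open>u \<in> nodes T\<close> \<open>v \<in> set (children T u)\<close>
        \<open>hd (v # u # p) = hd q\<close> by auto
    then show ?thesis using 2 \<open>hd (v # u # p) = hd q\<close> "2.IH"[of "u' # p'"] by auto
  qed
qed

lemma root_path_ex:
  assumes d: "distinct (labels T)" and "v \<in> nodes T"
  shows "\<exists>p. root_path T p \<and> hd p = v"
proof -
  have "\<exists>p. root_path T p \<and> hd p = root t"
    if "t \<in> psubtrees s" "s \<in> psubtrees T" "root_path T q" "hd q = root s" for s t q
    using that
  proof (induction s arbitrary: q)
    case (PNode x ts)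
    show ?case
    proof (cases "t = PNode x ts")
      case True
      then show ?thesis using PNode.prems by auto
    next
      case False
      then obtain r where r: "r \<in> set ts" "t \<in> psubtrees r" using PNode.prems by auto
      have "x \<in> nodes T" "root r \<in> set (children T x)"
        using children_root[OF d PNode.prems(2)] r(1) PNode.prems(2) nodes_eq_root_psubtrees[of T]
        by force+
      moreover have "root_path T (x # tl q)"
        using PNode.prems(3,4) root_path_nonempty[of T q] by (cases q) auto
      ultimately have "root_path T (root r # x # tl q)" by (rule root_path.intros(2)[rotated])
      then show ?thesis
        using PNode.IH[OF r] branch_psubtrees[OF PNode.prems(2)] r(1) by fastforce
    qed
  qed
  from this[OF _ self_psubtrees root_path.intros(1)] show ?thesis
    using assms(2) nodes_eq_root_psubtrees[of T] by auto
qed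

lemma ex1_path_to_root:
  assumes "distinct (labels T)" "v \<in> nodes T"
  shows "\<exists>!p. root_path T p \<and> hd p = v"
  using root_path_ex[OF assms] root_path_unique[OF assms(1)] by metis

lemma ex1_parent:
  assumes d: "distinct (labels T)" and "v \<in> nodes T" "v \<noteq> root T"
  shows "\<exists>!u. u \<in> nodes T \<and> v \<in> set (children T u)"
proof -
  obtain p where "root_path T p" "hd p = v" using root_path_ex[OF assms(1,2)] by auto
  then have "\<exists>u. u \<in> nodes T \<and> v \<in> set (children T u)"
    by (cases rule: root_path.cases) (use assms(3) in auto)
  then show ?thesis using parent_unique[OF d] by metis
qed

section \<open>The map \<open>varphi\<close> is the bijection between plane trees and binary trees\<close>

lemma forest_of_varphi_forest [simp]: "forest_of (varphi_forest ts) = ts"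
  by (induction ts rule: varphi_forest.induct) auto

lemma varphi_forest_forest_of [simp]: "varphi_forest (forest_of B) = B"
  by (induction B) auto

lemma preorder_varphi_forest: "preorder (varphi_forest ts) = concat (map labels ts)"
  by (induction ts rule: varphi_forest.induct) auto

lemma varphi_varphi_inv: "varphi (varphi_inv B) = B"
  by (simp add: varphi_def varphi_inv_def)

lemma varphi_inv_varphi: "root T = 0 \<Longrightarrow> varphi_inv (varphi T) = T"
  by (cases T) (simp add: varphi_def varphi_inv_def)

lemma varphi_in_binary_trees:
  assumes "T \<in> plane_trees n"
  shows "varphi T \<in> binary_trees n"
proof -
  obtain t ts where T: "T = PNode 0 (t # ts)" "root t = 1"
    using assms by (cases T) (auto simp: plane_trees_def)
  obtain cs where t: "t = PNode 1 cs" using T(2) by (cases t) auto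
  have "set_tree (varphi T) = {1..n}"
  proof -
    have "set (labels T) = insert 0 (set_tree (varphi T))" "0 \<notin> set_tree (varphi T)"
      using assms
      by (auto simp: plane_trees_def T(1) varphi_def preorder_varphi_forest simp flip: set_preorder)
    moreover have "set (labels T) = {0..n}" using assms by (simp add: plane_trees_def nodes_def)
    ultimately have "set_tree (varphi T) = {0..n} - {0}" by auto
    also have "\<dots> = {1..n}" by (auto simp: Suc_le_eq)
    finally show ?thesis .
  qed
  moreover have "distinct (preorder (varphi T))"
    using assms by (simp add: plane_trees_def T(1) varphi_def preorder_varphi_forest)
  ultimately show ?thesis by (auto simp: binary_trees_def T t varphi_def)
qed

lemma varphi_inv_in_plane_trees:
  assumes "B \<in> binary_trees n"
  shows "varphi_inv B \<in> plane_trees n"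
proof -
  have l: "labels (varphi_inv B) = 0 # preorder B"
    using preorder_varphi_forest[of "forest_of B"] by (simp add: varphi_inv_def)
  have "insert 0 {1..n} = {0..n}" by auto
  then show ?thesis
    using assms l by (auto simp: plane_trees_def binary_trees_def nodes_def varphi_inv_def)
qed

lemma bij_betw_varphi: "bij_betw varphi (plane_trees n) (binary_trees n)"
  by (rule bij_betw_byWitness[where f' = varphi_inv])
    (auto simp: varphi_varphi_inv varphi_in_binary_trees varphi_inv_in_plane_trees,
      auto simp: plane_trees_def varphi_inv_varphi)

lemma inv_into_varphi: "B \<in> binary_trees n \<Longrightarrow> inv_into (plane_trees n) varphi B = varphi_inv B"
  using bij_betw_varphi[of n]
  by (intro inv_into_f_eq) (auto simp: bij_betw_def varphi_varphi_inv varphi_inv_in_plane_trees)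

lemma set_tree_mirror: "set_tree (mirror B) = set_tree B"
  by (induction B) auto

lemma mirror_in_binary_trees: "B \<in> binary_trees n \<Longrightarrow> mirror B \<in> binary_trees n"
proof -
  have "distinct (preorder (mirror B)) = distinct (preorder B)" for B :: "nat tree"
    by (metis card_distinct distinct_card length_preorder set_preorder set_tree_mirror size_mirror)
  then show "B \<in> binary_trees n \<Longrightarrow> mirror B \<in> binary_trees n"
    unfolding binary_trees_def mem_Collect_eq set_tree_mirror by (metis mirror.simps(2))
qed

lemma phi_tilde_in_plane_trees: "T \<in> plane_trees n \<Longrightarrow> phi_tilde T \<in> plane_trees n"
  by (simp add: phi_tilde_def varphi_in_binary_trees varphi_inv_in_plane_trees mirror_in_binary_trees)

lemma varphi_phi_tilde: "varphi (phi_tilde T) = mirror (varphi T)"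
  by (simp add: phi_tilde_def varphi_varphi_inv)

lemma subtrees_varphi_forest:
  "\<langle>l, x, r\<rangle> \<in> subtrees (varphi_forest ts) \<longleftrightarrow>
   (\<exists>cs rest. l = varphi_forest cs \<and> r = varphi_forest rest \<and>
      ((\<exists>pre. ts = pre @ PNode x cs # rest) \<or>
       (\<exists>t\<in>set ts. \<exists>s\<in>psubtrees t. \<exists>pre. branches s = pre @ PNode x cs # rest)))"
proof -
  define P where "P us cs rest \<longleftrightarrow> (\<exists>pre. us = pre @ PNode x cs # rest) \<or>
    (\<exists>t\<in>set us. \<exists>s\<in>psubtrees t. \<exists>pre. branches s = pre @ PNode x cs # rest)"
    for us cs rest
  have P_Nil: "\<not> P [] cs rest" for cs rest by (simp add: P_def)
  have P_Cons: "P (PNode y ks # us) cs rest \<longleftrightarrow>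
      (y = x \<and> ks = cs \<and> us = rest) \<or> P ks cs rest \<or> P us cs rest" for y ks us cs rest
  proof -
    have "(\<exists>pre. PNode y ks # us = pre @ PNode x cs # rest) \<longleftrightarrow>
        (y = x \<and> ks = cs \<and> us = rest) \<or> (\<exists>pre. us = pre @ PNode x cs # rest)"
      by (auto simp: Cons_eq_append_conv)
    moreover have "(\<exists>s\<in>psubtrees (PNode y ks). \<exists>pre. branches s = pre @ PNode x cs # rest) \<longleftrightarrow>
        P ks cs rest"
      by (auto simp: P_def)
    ultimately show ?thesis unfolding P_def by (simp only: list.set(2) bex_simps) blast
  qed
  have "\<langle>l, x, r\<rangle> \<in> subtrees (varphi_forest us) \<longleftrightarrow>
      (\<exists>cs rest. l = varphi_forest cs \<and> r = varphi_forest rest \<and> P us cs rest)" for us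
  proof (induction us rule: varphi_forest.induct)
    case 1
    then show ?case by (simp add: P_Nil)
  next
    case (2 y ks us)
    have "\<langle>l, x, r\<rangle> \<in> subtrees (varphi_forest (PNode y ks # us)) \<longleftrightarrow>
        (y = x \<and> l = varphi_forest ks \<and> r = varphi_forest us) \<or>
        \<langle>l, x, r\<rangle> \<in> subtrees (varphi_forest ks) \<or> \<langle>l, x, r\<rangle> \<in> subtrees (varphi_forest us)"
      by auto
    then show ?case unfolding 2 P_Cons by blast
  qed
  then show ?thesis by (simp only: P_def)
qed

lemma subtrees_varphi:
  "\<langle>l, x, r\<rangle> \<in> subtrees (varphi T) \<longleftrightarrow>
   (\<exists>s\<in>psubtrees T. \<exists>pre cs rest. branches s = pre @ PNode x cs # rest \<and>
      l = varphi_forest cs \<and> r = varphi_forest rest)"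
proof (cases T)
  case (PNode y ts)
  show ?thesis
    unfolding varphi_def PNode ptree.sel subtrees_varphi_forest psubtrees.simps
    by (simp only: bex_simps ptree.sel) blast
qed

lemma varphi_forest_eq_Leaf: "varphi_forest ts = \<langle>\<rangle> \<longleftrightarrow> ts = []"
  by (cases ts rule: varphi_forest.cases) auto

lemma varphi_forest_eq_Node:
  "varphi_forest ts = \<langle>l, y, r\<rangle> \<longleftrightarrow>
   (\<exists>cs us. ts = PNode y cs # us \<and> l = varphi_forest cs \<and> r = varphi_forest us)"
  by (cases ts rule: varphi_forest.cases) auto

lemma left_child_varphi:
  assumes T: "distinct (labels T)"
  shows "left_child (varphi T) x y \<longleftrightarrow>
    x \<in> nodes T - {root T} \<and> (\<exists>ys. children T x = y # ys)"
proof
  assume "left_child (varphi T) x y"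
  then obtain s pre cs us rest where s: "s \<in> psubtrees T"
    "branches s = pre @ PNode x (PNode y cs # us) # rest"
    by (auto simp: left_child_def subtrees_varphi varphi_forest_eq_Node varphi_forest_eq_Node[THEN eq_iff_swap])
  define t where "t = PNode x (PNode y cs # us)"
  have t: "t \<in> psubtrees T" using s branch_psubtrees by (fastforce simp: t_def)
  have "x \<in> set (children T (root s))" using children_root[OF T s(1)] s(2) by simp
  then have "x \<noteq> root T"
    using root_notin_children[OF T] s(1) nodes_eq_root_psubtrees[of T] by auto
  moreover have "x \<in> nodes T" using t nodes_eq_root_psubtrees[of T] by (force simp: t_def)
  moreover have "children T x = y # map root us" using children_root[OF T t] by (simp add: t_def)
  ultimately show "x \<in> nodes T - {root T} \<and> (\<exists>ys. children T x = y # ys)" by blast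
next
  assume a: "x \<in> nodes T - {root T} \<and> (\<exists>ys. children T x = y # ys)"
  then obtain u where u: "u \<in> nodes T" "x \<in> set (children T u)" using ex1_parent[OF T] by blast
  obtain s where s: "s \<in> psubtrees T" "children T u = map root (branches s)"
    using children_eqE[OF T u(1)] by metis
  obtain t where t: "t \<in> set (branches s)" "root t = x" using u(2) s(2) by auto
  obtain pre rest where "branches s = pre @ t # rest" using split_list[OF t(1)] by blast
  moreover have "t = PNode x (branches t)" using t(2) by (cases t) auto
  ultimately have "\<langle>varphi_forest (branches t), x, varphi_forest rest\<rangle> \<in> subtrees (varphi T)"
    using s(1) unfolding subtrees_varphi by metis
  moreover have "\<exists>ys. map root (branches t) = y # ys"
    using a children_root[OF T branch_psubtrees[OF s(1) t(1)]] t(2) by simp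
  then obtain t' us where "branches t = t' # us" "root t' = y" by (auto simp: map_eq_Cons_conv)
  then have "\<exists>l r. varphi_forest (branches t) = \<langle>l, y, r\<rangle>" by (cases t') auto
  ultimately show "left_child (varphi T) x y" unfolding left_child_def by metis
qed

lemma right_child_varphi:
  assumes T: "distinct (labels T)"
  shows "right_child (varphi T) x y \<longleftrightarrow>
    (\<exists>u\<in>nodes T. \<exists>xs ys. children T u = xs @ x # y # ys)"
proof
  assume "right_child (varphi T) x y"
  then obtain s pre cs cs' us where s: "s \<in> psubtrees T"
    "branches s = pre @ PNode x cs # PNode y cs' # us"
    by (auto simp: right_child_def subtrees_varphi varphi_forest_eq_Node varphi_forest_eq_Node[THEN eq_iff_swap])
  have "children T (root s) = map root pre @ x # y # map root us"
    using children_root[OF T s(1)] s(2) by simp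
  then show "\<exists>u\<in>nodes T. \<exists>xs ys. children T u = xs @ x # y # ys"
    using s(1) nodes_eq_root_psubtrees[of T] by blast
next
  assume "\<exists>u\<in>nodes T. \<exists>xs ys. children T u = xs @ x # y # ys"
  then obtain u xs ys where u: "u \<in> nodes T" "children T u = xs @ x # y # ys" by blast
  obtain s where s: "s \<in> psubtrees T" "children T u = map root (branches s)"
    using children_eqE[OF T u(1)] by metis
  obtain pre t t' us where b: "branches s = pre @ t # t' # us" "root t = x" "root t' = y"
    using u(2) s(2) by (auto simp: map_eq_append_conv map_eq_Cons_conv)
  have "branches s = pre @ PNode x (branches t) # PNode y (branches t') # us"
    using b by (cases t; cases t') auto
  then have "\<langle>varphi_forest (branches t), x, varphi_forest (PNode y (branches t') # us)\<rangle>
      \<in> subtrees (varphi T)"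
    using s(1) unfolding subtrees_varphi by blast
  then show "right_child (varphi T) x y"
    unfolding right_child_def varphi_forest.simps by metis
qed

lemma right_child_complete:
  "right_child (complete par B) (Orig x) (Primed y) \<longleftrightarrow>
   (\<exists>l. \<langle>l, x, \<langle>\<rangle>\<rangle> \<in> subtrees B \<and> y = par x)"
proof -
  have root: "\<exists>x. complete par B = \<langle>l, Orig x, r\<rangle>" if "complete par B = \<langle>l, z, r\<rangle>" for B l z r
    using that by (cases B) auto
  have "(\<exists>l' l r. \<langle>l', Orig x, \<langle>l, Primed y, r\<rangle>\<rangle> \<in> subtrees (complete par B)) \<longleftrightarrow>
    (\<exists>l. \<langle>l, x, \<langle>\<rangle>\<rangle> \<in> subtrees B \<and> y = par x)"
  proof (induction B)
    case Leaf
    then show ?case by simp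
  next
    case (Node l v r)
    have "complete par r \<noteq> \<langle>a, Primed b, c\<rangle>" for a b c using root[of r a "Primed b" c] by auto
    then show ?case using Node by (auto simp: eq_commute[of "\<langle>_, _, _\<rangle>" "complete par r"])
  qed
  then show ?thesis by (simp add: right_child_def)
qed

lemma no_right_child_varphi:
  assumes T: "distinct (labels T)"
  shows "(\<exists>l. \<langle>l, x, \<langle>\<rangle>\<rangle> \<in> subtrees (varphi T)) \<longleftrightarrow>
    (\<exists>u\<in>nodes T. \<exists>xs. children T u = xs @ [x])"
proof
  assume "\<exists>l. \<langle>l, x, \<langle>\<rangle>\<rangle> \<in> subtrees (varphi T)"
  then obtain s pre cs where s: "s \<in> psubtrees T" "branches s = pre @ [PNode x cs]"
    by (auto simp: subtrees_varphi varphi_forest_eq_Leaf varphi_forest_eq_Leaf[THEN eq_iff_swap])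
  then show "\<exists>u\<in>nodes T. \<exists>xs. children T u = xs @ [x]"
    using children_root[OF T s(1)] nodes_eq_root_psubtrees[of T] by auto
next
  assume "\<exists>u\<in>nodes T. \<exists>xs. children T u = xs @ [x]"
  then obtain u xs where u: "u \<in> nodes T" "children T u = xs @ [x]" by blast
  obtain s where s: "s \<in> psubtrees T" "children T u = map root (branches s)"
    using children_eqE[OF T u(1)] by metis
  obtain pre t where b: "branches s = pre @ [t]" "root t = x"
    using u(2) s(2) by (auto simp: map_eq_append_conv map_eq_Cons_conv)
  then have "branches s = pre @ PNode x (branches t) # []" by (cases t) auto
  then show "\<exists>l. \<langle>l, x, \<langle>\<rangle>\<rangle> \<in> subtrees (varphi T)"
    using s(1) varphi_forest.simps(1) unfolding subtrees_varphi by metis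
qed

lemma right_child_complement:
  assumes T: "distinct (labels T)"
  shows "right_child (complement T) (Orig x) (Primed u) \<longleftrightarrow>
    u \<in> nodes T \<and> (\<exists>xs. children T u = xs @ [x])"
proof -
  have "parent T x = w" if "w \<in> nodes T" "children T w = xs @ [x]" for w xs
    using parent_eqI[OF T that(1)] that(2) by simp
  then show ?thesis
    using no_right_child_varphi[OF T, of x] unfolding complement_def right_child_complete by auto
qed

lemma ex1_leadsto:
  assumes T: "T \<in> plane_trees n" and v: "v \<in> nodes T"
  shows "\<exists>!u. leadsto T v u"
proof -
  let ?T' = "phi_tilde T"
  have d: "distinct (labels T)" "root T = 0" and n: "nodes T = {0..n}"
    using T by (auto simp: plane_trees_def)
  have d': "distinct (labels ?T')" "root ?T' = 0" and n': "nodes ?T' = nodes T"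
    using T phi_tilde_in_plane_trees[OF T] by (auto simp: plane_trees_def)
  have lc: "left_child B x y \<longleftrightarrow> right_child (mirror B) x y" for B :: "nat tree" and x y
  proof -
    have "mirror ` subtrees B = subtrees (mirror B)" for B :: "nat tree"
      by (induction B) (auto simp: image_Un)
    then have "t \<in> subtrees B \<longleftrightarrow> mirror t \<in> subtrees (mirror B)" for t and B :: "nat tree"
      by (metis image_eqI imageE mirror_mirror)
    then have "mirror t \<in> subtrees B \<longleftrightarrow> t \<in> subtrees (mirror B)" for t and B :: "nat tree"
      by (metis mirror_mirror)
    from this[symmetric] show ?thesis
      unfolding left_child_def right_child_def by simp (metis mirror_mirror)
  qed
  have one: "right_child (complement T) (Orig u) (Primed v) \<longleftrightarrow> (\<exists>xs. children T v = xs @ [u])" for u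
    using right_child_complement[OF d(1)] v by simp
  have two: "right_child (complement ?T') (Orig v) (Primed u) \<longleftrightarrow>
      u \<in> nodes T \<and> (\<exists>xs. children ?T' u = xs @ [v])" for u
    using right_child_complement[OF d'(1)] n' by simp
  have root_int: "children T 0 \<noteq> []"
    using T children_root[OF d(1) self_psubtrees] d(2) by (auto simp: plane_trees_def)
  have key: "(\<exists>y. left_child (varphi T) v y) \<longleftrightarrow> v \<noteq> 0 \<and> children T v \<noteq> []"
    using left_child_varphi[OF d(1)] v d(2) by (auto simp: neq_Nil_conv)
  have key': "(\<exists>y. left_child (varphi T) v y) \<longleftrightarrow>
      (\<exists>y. \<exists>w\<in>nodes ?T'. \<exists>xs ys. children ?T' w = xs @ v # y # ys)"
    unfolding lc varphi_phi_tilde[symmetric] right_child_varphi[OF d'(1)] ..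
  show ?thesis
  proof (cases "children T v = []")
    case False
    define u where "u = last (children T v)"
    have u: "children T v = butlast (children T v) @ [u]" using False by (simp add: u_def)
    then have "u \<in> set (children T v)" using False by (simp add: u_def)
    then have un: "u \<in> nodes T" using children_in_nodes[OF d(1) v] by simp
    have no: "\<not> (u' \<in> nodes T \<and> (\<exists>xs. children ?T' u' = xs @ [v]))" for u'
    proof
      assume a: "u' \<in> nodes T \<and> (\<exists>xs. children ?T' u' = xs @ [v])"
      then obtain xs where xs: "u' \<in> nodes ?T'" "children ?T' u' = xs @ [v]" using n' by auto
      have "v \<noteq> 0" using root_notin_children[OF d'(1) xs(1)] xs(2) d'(2) by auto
      then obtain y w as bs where w: "w \<in> nodes ?T'" "children ?T' w = as @ v # y # bs"
        using key key' False by blast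
      have "w = u'" by (rule parent_unique[OF d'(1) w(1) xs(1), of v]) (simp_all add: w xs)
      moreover obtain s where "s \<in> psubtrees ?T'" "children ?T' w = map root (branches s)"
        using children_eqE[OF d'(1) w(1)] by metis
      moreover have "distinct (children ?T' w)"
        by (rule distinct_children[OF d'(1) w(1)])
      ultimately show False using w(2) xs(2) by (auto simp: append_eq_append_conv2 Cons_eq_append_conv append_eq_Cons_conv)
    qed
    have "leadsto T v w \<longleftrightarrow> w = u" for w
      unfolding leadsto_def one two using no v un u by (metis last_snoc)
    then show ?thesis by simp
  next
    case True
    then have "v \<noteq> 0" using root_int by metis
    then obtain w where w: "w \<in> nodes ?T'" "v \<in> set (children ?T' w)"
      using ex1_parent[OF d'(1)] v n' d'(2) by metis
    obtain xs ys where xy: "children ?T' w = xs @ v # ys" using split_list[OF w(2)] by blast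
    have "ys = []" using True key key' w(1) xy by (cases ys) auto
    then have xs: "children ?T' w = xs @ [v]" using xy by simp
    have "u \<in> nodes T \<and> (\<exists>xs. children ?T' u = xs @ [v]) \<longleftrightarrow> u = w" for u
    proof
      assume "u \<in> nodes T \<and> (\<exists>xs. children ?T' u = xs @ [v])"
      then have "u \<in> nodes ?T'" "v \<in> set (children ?T' u)" using n' by auto
      then show "u = w" using parent_unique[OF d'(1) _ w(1)] w(2) by simp
    next
      assume "u = w"
      then show "u \<in> nodes T \<and> (\<exists>xs. children ?T' u = xs @ [v])" using w(1) n' xs by simp
    qed
    then have "leadsto T v u \<longleftrightarrow> u = w" for u
      unfolding leadsto_def one two using True v w(1) n' by auto
    then show ?thesis by simp
  qed
qed

end

theory Submission
  imports Defs
begin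

text \<open>
  The added node \<open>v'\<close> is a leaf of the complement of \<open>B = varphi T\<close>, and \<open>v \<leadsto> u\<close> says that the
  mirror image carries the leaf \<open>v'\<close> to the leaf \<open>u'\<close>. All four statistics of \<open>v\<close> can be read off
  the path in \<open>B\<close> from the root to \<open>v'\<close>. The level is the number of its left steps and \<open>lsw\<close> that of
  its right steps; \<open>rsw\<close> adds up the right spines hanging off the left steps and the length of the
  final run of right steps, and \<open>dual_rsw\<close> is the same with left and right exchanged. So the mirror
  image swaps the statistics in pairs.
\<close>

section \<open>Contexts in binary trees\<close>

text \<open>
  A context is a path in a binary tree together with the subtrees hanging off it, listed from its
  end up to the root of the tree.
\<close>

datatype 'a step = is_left: GoL (lab: 'a) (off: "'a tree") | GoR (lab: 'a) (off: "'a tree")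

fun plug :: "'a step list \<Rightarrow> 'a tree \<Rightarrow> 'a tree" where
  "plug [] t = t"
| "plug (GoL x r # c) t = plug c \<langle>t, x, r\<rangle>"
| "plug (GoR x l # c) t = plug c \<langle>l, x, t\<rangle>"

fun turn :: "'a step \<Rightarrow> 'a step" where
  "turn (GoL x t) = GoR x (mirror t)"
| "turn (GoR x t) = GoL x (mirror t)"

lemma is_left_turn [simp]: "is_left (turn s) \<longleftrightarrow> \<not> is_left s"
  by (cases s) auto

lemma off_turn [simp]: "off (turn s) = mirror (off s)"
  by (cases s) auto

lemma plug_append: "plug (c @ c') t = plug c' (plug c t)"
  by (induction c t rule: plug.induct) auto

lemma mirror_plug: "mirror (plug c t) = plug (map turn c) (mirror t)"
  by (induction c t rule: plug.induct) auto

lemma subtrees_plug: "t \<in> subtrees (plug c t)"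
proof -
  have "subtrees t \<subseteq> subtrees (plug c t)"
    by (induction c t rule: plug.induct) auto
  moreover have "t \<in> subtrees t" by (cases t) auto
  ultimately show ?thesis by blast
qed

text \<open>Each step records a node of the whole tree together with the subtree off the path, so
  facts about subtrees of \<open>varphi T\<close> can be applied step by step.\<close>

lemma subtrees_plug_step:
  assumes "s \<in> set c"
  shows "if is_left s then \<exists>l. \<langle>l, lab s, off s\<rangle> \<in> subtrees (plug c t)
    else \<exists>r. \<langle>off s, lab s, r\<rangle> \<in> subtrees (plug c t)"
proof -
  obtain c1 c2 where "c = c1 @ s # c2" using split_list[OF assms] by blast
  then have "plug c t = plug c2 (plug [s] (plug c1 t))" by (cases s) (simp_all add: plug_append)
  then show ?thesis using subtrees_plug[of "plug [s] (plug c1 t)" c2] by (cases s) auto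
qed

lemma set_preorder_plug: "set (preorder (plug c t)) \<supseteq> set (preorder t)"
  by (induction c t rule: plug.induct) auto

text \<open>Needed to turn cardinalities and sums over sets of names into counts and sums over the
  steps of a context.\<close>

lemma distinct_labs: "distinct (preorder (plug c t)) \<Longrightarrow> distinct (map lab c @ preorder t)"
proof (induction c t rule: plug.induct)
  case (2 x r c t)
  then show ?case by auto
next
  case (3 x l c t)
  then show ?case by auto
qed simp

text \<open>A name fixes its position: at the first disagreement of the two paths below the root,
  \<open>x\<close> would occur twice. Root steps come last in a context, hence the reverse
  induction.\<close>

lemma plug_unique:
  assumes "distinct (preorder (plug c \<langle>l, x, r\<rangle>))"
    and "plug c \<langle>l, x, r\<rangle> = plug c' \<langle>l', x, r'\<rangle>"
  shows "c = c' \<and> l = l' \<and> r = r'"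
  using assms
proof (induction c arbitrary: c' rule: rev_induct)
  case Nil
  then show ?case
  proof (cases c' rule: rev_cases)
    case (snoc c1 s)
    then show ?thesis using Nil set_preorder_plug[of "\<langle>l', x, r'\<rangle>" c1]
      by (cases s) (auto simp: plug_append)
  qed simp
next
  case (snoc s c)
  have x: "x \<in> set (preorder (plug d \<langle>k, x, k'\<rangle>))" for d k k'
    using set_preorder_plug[of "\<langle>k, x, k'\<rangle>" d] by auto
  show ?case
  proof (cases c' rule: rev_cases)
    case Nil
    then show ?thesis using snoc.prems x[of c l r] by (cases s) (auto simp: plug_append)
  next
    case c': (snoc c1 s')
    show ?thesis
    proof (cases s; cases s')
      fix y t y' t' assume "s = GoL y t" "s' = GoL y' t'"
      then show ?thesis using snoc c' by (auto simp: plug_append)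
    next
      fix y t y' t' assume "s = GoR y t" "s' = GoR y' t'"
      then show ?thesis using snoc c' by (auto simp: plug_append)
    next
      fix y t y' t' assume "s = GoL y t" "s' = GoR y' t'"
      then show ?thesis using snoc.prems c' x[of c l r] x[of c1 l' r'] by (auto simp: plug_append)
    next
      fix y t y' t' assume "s = GoR y t" "s' = GoL y' t'"
      then show ?thesis using snoc.prems c' x[of c l r] x[of c1 l' r'] by (auto simp: plug_append)
    qed
  qed
qed

section \<open>Statistics of contexts\<close>

text \<open>Under \<open>varphi_forest\<close>, a right spine is a row of siblings and a left spine
  is a left chain.\<close>

fun right_spine :: "'a tree \<Rightarrow> nat" where
  "right_spine \<langle>\<rangle> = 0"
| "right_spine \<langle>l, x, r\<rangle> = Suc (right_spine r)"

fun left_spine :: "'a tree \<Rightarrow> nat" where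
  "left_spine \<langle>\<rangle> = 0"
| "left_spine \<langle>l, x, r\<rangle> = Suc (left_spine l)"

lemma left_spine_mirror [simp]: "left_spine (mirror t) = right_spine t"
  by (induction t) auto

lemma right_spine_mirror [simp]: "right_spine (mirror t) = left_spine t"
  by (induction t) auto

abbreviation is_right :: "'a step \<Rightarrow> bool" where
  "is_right s \<equiv> \<not> is_left s"

text \<open>A context starts at the far end of its path, so \<open>takeWhile\<close> measures the
  run of steps farthest from the root.\<close>

definition right_width :: "'a step list \<Rightarrow> nat" where
  "right_width c =
     length (takeWhile is_right c) + (\<Sum>s\<leftarrow>filter is_left c. right_spine (off s))"

definition left_width :: "'a step list \<Rightarrow> nat" where
  "left_width c =
     length (takeWhile is_left c) + (\<Sum>s\<leftarrow>filter is_right c. left_spine (off s))"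

lemma left_width_turn: "left_width (map turn c) = right_width c"
  by (simp add: left_width_def right_width_def takeWhile_map filter_map o_def)

lemma right_width_turn: "right_width (map turn c) = left_width c"
  by (simp add: left_width_def right_width_def takeWhile_map filter_map o_def)

section \<open>Contexts and statistics of plane trees\<close>

text \<open>\<open>elder\<close> ranges over all splittings of all child lists; as the parent is
  unique and child lists have no repetitions, only one splitting at \<open>v\<close> exists.\<close>

lemma elder_eq:
  assumes d: "distinct (labels T)" and u: "u \<in> nodes T" "children T u = xs @ v # ys"
  shows "elder T v = set xs"
proof -
  have 1: "as @ w # bs = xs" if "u' \<in> nodes T" "children T u' = as @ w # bs @ v # cs" for u' as w bs cs
  proof -
    have "u' = u" by (rule parent_unique[OF d that(1) u(1), of v]) (simp_all add: that u)
    then have eq: "(as @ w # bs) @ v # cs = xs @ v # ys" using that u by simp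
    have nin: "v \<notin> set (as @ w # bs)" "v \<notin> set cs"
      using distinct_children[OF d that(1)] that(2) by auto
    with eq show ?thesis using append_Cons_eq_iff[OF nin, of xs ys] by blast
  qed
  have 2: "\<exists>as bs. children T u = as @ w # bs @ v # ys" if "w \<in> set xs" for w
    using split_list[OF that] u(2) by force
  show ?thesis
  proof (intro equalityI subsetI)
    fix w assume "w \<in> elder T v"
    then obtain u' as bs cs where "u' \<in> nodes T" "children T u' = as @ w # bs @ v # cs"
      unfolding elder_def by blast
    then have "as @ w # bs = xs" by (rule 1)
    then show "w \<in> set xs" by auto
  next
    fix w assume "w \<in> set xs"
    then show "w \<in> elder T v" using 2[of w] u(1) unfolding elder_def by blast
  qed
qed

lemma younger_eq:
  assumes d: "distinct (labels T)" and u: "u \<in> nodes T" "children T u = xs @ v # ys"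
  shows "younger T v = set ys"
proof -
  have 1: "bs @ w # cs = ys" if "u' \<in> nodes T" "children T u' = as @ v # bs @ w # cs" for u' as w bs cs
  proof -
    have "u' = u" by (rule parent_unique[OF d that(1) u(1), of v]) (simp_all add: that u)
    then have eq: "as @ v # bs @ w # cs = xs @ v # ys" using that u by simp
    have nin: "v \<notin> set as" "v \<notin> set (bs @ w # cs)"
      using distinct_children[OF d that(1)] that(2) by auto
    with eq show ?thesis using append_Cons_eq_iff[OF nin, of xs ys] by blast
  qed
  have 2: "\<exists>bs cs. children T u = xs @ v # bs @ w # cs" if "w \<in> set ys" for w
    using split_list[OF that] u(2) by force
  show ?thesis
  proof (intro equalityI subsetI)
    fix w assume "w \<in> younger T v"
    then obtain u' as bs cs where "u' \<in> nodes T" "children T u' = as @ v # bs @ w # cs"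
      unfolding younger_def by blast
    then have "bs @ w # cs = ys" by (rule 1)
    then show "w \<in> set ys" by auto
  next
    fix w assume "w \<in> set ys"
    then show "w \<in> younger T v" using 2[of w] u(1) unfolding younger_def by blast
  qed
qed

lemma elder_root: "distinct (labels T) \<Longrightarrow> elder T (root T) = {}"
  using root_notin_children[of T] by (fastforce simp: elder_def)

lemma younger_root: "distinct (labels T) \<Longrightarrow> younger T (root T) = {}"
  using root_notin_children[of T] by (fastforce simp: younger_def)

section \<open>Spines and runs of siblings in \<open>varphi T\<close>\<close>

lemma right_spine_varphi_forest: "right_spine (varphi_forest ts) = length ts"
  by (induction ts rule: varphi_forest.induct) auto

text \<open>The \<open>Suc\<close> stands for the root of \<open>t\<close>, so the left spine counts
  the edges of the left chain.\<close>

lemma length_left_chain: "length (left_chain t) = Suc (left_spine (varphi_forest (branches t)))"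
proof (induction t rule: left_chain.induct)
  case (2 x t ts)
  then show ?case by (cases t) auto
qed simp

text \<open>The left subtree of \<open>x\<close> encodes the forest below \<open>x\<close>, the
  right subtree the forest of its younger siblings.\<close>

lemma spines_varphi:
  assumes d: "distinct (labels T)" and "\<langle>l, x, r\<rangle> \<in> subtrees (varphi T)"
  shows "lchain T x = left_spine l" and "card (younger T x) = right_spine r"
proof -
  obtain s pre cs rest where s: "s \<in> psubtrees T" "branches s = pre @ PNode x cs # rest"
    "l = varphi_forest cs" "r = varphi_forest rest"
    using assms(2) unfolding subtrees_varphi by blast
  have "PNode x cs \<in> psubtrees T" using branch_psubtrees[OF s(1)] s(2) by simp
  then show "lchain T x = left_spine l"
    using subtree_at_eqI[OF d, of "PNode x cs"] s(3) by (simp add: lchain_def length_left_chain)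
  have u: "root s \<in> nodes T" using s(1) nodes_eq_root_psubtrees[of T] by blast
  have ch: "children T (root s) = map root pre @ x # map root rest"
    using children_root[OF d s(1)] s(2) by simp
  show "card (younger T x) = right_spine r"
    using younger_eq[OF d u ch] distinct_children[OF d u] s(4)
    by (simp add: ch right_spine_varphi_forest distinct_card del: set_map)
qed

definition right_run :: "'a ptree list \<Rightarrow> 'a step list" where
  "right_run ts = rev (map (\<lambda>t. GoR (root t) (varphi_forest (branches t))) ts)"

text \<open>Walking past the trees of \<open>ts\<close> by right steps leads to the rest of the
  forest.\<close>

lemma plug_right_run: "plug (right_run ts) (varphi_forest us) = varphi_forest (ts @ us)"
proof (induction ts)
  case (Cons t ts)
  then show ?case by (cases t) (simp add: right_run_def plug_append)
qed (simp add: right_run_def)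

lemma right_run_steps [simp]:
  "filter is_left (right_run ts) = []"
  "filter is_right (right_run ts) = right_run ts"
  "lab ` set (right_run ts) = root ` set ts"
  "length (right_run ts) = length ts"
  "right_run ts = [] \<longleftrightarrow> ts = []"
  "s \<in> set (right_run ts) \<Longrightarrow> is_right s"
  by (auto simp: right_run_def rev_filter[symmetric] filter_map o_def image_image)

lemma takeWhile_is_left_right_run:
  "takeWhile is_left (right_run ts @ c) = (if ts = [] then takeWhile is_left c else [])"
proof (cases ts)
  case (Cons t ts')
  then obtain s k where "right_run ts = s # k" by (cases "right_run ts") auto
  then show ?thesis using right_run_steps(6)[of s ts] Cons by simp
qed (simp add: right_run_def)

text \<open>The context leads to the forest of children of the node \<open>hd p\<close>. Its left
  steps are the non-root nodes of \<open>p\<close>, its right steps their elder siblings.\<close>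

lemma context_of_path:
  assumes d: "distinct (labels T)"
  shows "root_path T p \<Longrightarrow> hd p \<in> nodes T \<and> (\<exists>c.
    varphi T = plug c (varphi_forest (branches (subtree_at T (hd p)))) \<and>
    map lab (filter is_left c) = butlast p \<and>
    lab ` set (filter is_right c) = (\<Union>w\<in>set p. elder T w) \<and>
    (c = [] \<and> p = [root T] \<or> (\<exists>r c'. c = GoL (hd p) r # c')) \<and>
    length (takeWhile is_left c) =
      (if \<forall>w\<in>set p. elder T w = {} then length p - 1
       else length (takeWhile (\<lambda>w. elder T w = {}) p) + 1))"
proof (induction rule: root_path.induct)
  case 1
  then show ?case
    using subtree_at_eqI[OF d self_psubtrees] elder_root[OF d] root_in_labels[of T]
    by (auto simp: varphi_def intro!: exI[of _ "[]"])
next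
  case (2 u p v)
  from "2.IH" obtain c where c: "varphi T = plug c (varphi_forest (branches (subtree_at T u)))"
    "map lab (filter is_left c) = butlast (u # p)"
    "lab ` set (filter is_right c) = (\<Union>w\<in>set (u # p). elder T w)"
    "length (takeWhile is_left c) =
      (if \<forall>w\<in>set (u # p). elder T w = {} then length (u # p) - 1
       else length (takeWhile (\<lambda>w. elder T w = {}) (u # p)) + 1)"
    unfolding list.sel by blast
  obtain s where s: "s \<in> psubtrees T" "root s = u" "children T u = map root (branches s)"
    using children_eqE[OF d "2.hyps"(2)] .
  obtain t where t: "t \<in> set (branches s)" "root t = v" using "2.hyps"(3) s(3) by auto
  obtain pre rest where b: "branches s = pre @ t # rest" using split_list[OF t(1)] by blast
  have ch: "children T u = map root pre @ v # map root rest" using s(3) b t(2) by simp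
  have el: "elder T v = root ` set pre" using elder_eq[OF d "2.hyps"(2) ch] by simp
  have su: "subtree_at T u = s" using subtree_at_eqI[OF d s(1)] s(2) by simp
  have sv: "subtree_at T v = t"
    using subtree_at_eqI[OF d branch_psubtrees[OF s(1) t(1)]] t(2) by simp
  have vt: "varphi_forest (t # rest) = \<langle>varphi_forest (branches t), v, varphi_forest rest\<rangle>"
    using t(2) by (cases t) auto
  \<comment> \<open>From the children of \<open>u\<close>, pass the elder siblings of
    \<open>v\<close> by right steps, then descend to the left at \<open>v\<close>.\<close>
  let ?c = "GoL v (varphi_forest rest) # right_run pre @ c"
  have "varphi T = plug ?c (varphi_forest (branches (subtree_at T v)))"
    using c(1) plug_right_run[of pre "t # rest"] by (simp add: su sv b plug_append vt)
  moreover have "map lab (filter is_left ?c) = butlast (v # u # p)" using c(2) by simp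
  moreover have "lab ` set (filter is_right ?c) = (\<Union>w\<in>set (v # u # p). elder T w)"
    using c(3) by (simp add: el image_Un del: set_filter)
  \<comment> \<open>If \<open>pre\<close> is nonempty, the run is the single step at
    \<open>v\<close>, which is the \<open>+ 1\<close>; otherwise it continues into
    \<open>c\<close>.\<close>
  moreover have "length (takeWhile is_left ?c) =
      (if \<forall>w\<in>set (v # u # p). elder T w = {} then length (v # u # p) - 1
       else length (takeWhile (\<lambda>w. elder T w = {}) (v # u # p)) + 1)"
    using c(4) by (auto simp: takeWhile_is_left_right_run el)
  moreover have "v \<in> nodes T" using children_in_nodes[OF d "2.hyps"(2,3)] .
  ultimately show ?case by (intro conjI exI[of _ ?c]) auto
qed

text \<open>The context is the path to the added node named after \<open>v\<close>.\<close>

lemma statistics_context: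
  assumes d: "distinct (labels T)" and v: "v \<in> nodes T"
  obtains c where "varphi T = plug c \<langle>\<rangle>"
    and "lsw T v = length (filter is_right c)" and "lev T v = length (filter is_left c)"
    and "rsw T v = right_width c" and "dual_rsw T v = left_width c"
    and "children T v \<noteq> [] \<longrightarrow> (\<exists>l c'. c = GoR (last (children T v)) l # c')"
    and "children T v = [] \<and> v \<noteq> root T \<longrightarrow> (\<exists>r c'. c = GoL v r # c')"
proof -
  define p where "p = path_to_root T v"
  have p: "root_path T p" "hd p = v"
    using theI'[OF ex1_path_to_root[OF d v]] by (simp_all add: p_def path_to_root_def)
  define ts where "ts = branches (subtree_at T v)"
  obtain c where c: "varphi T = plug c (varphi_forest ts)"
    "map lab (filter is_left c) = butlast p"
    "lab ` set (filter is_right c) = (\<Union>w\<in>set p. elder T w)"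
    "c = [] \<and> p = [root T] \<or> (\<exists>r c'. c = GoL v r # c')"
    "length (takeWhile is_left c) =
      (if \<forall>w\<in>set p. elder T w = {} then length p - 1
       else length (takeWhile (\<lambda>w. elder T w = {}) p) + 1)"
    using context_of_path[OF d p(1)] p(2) unfolding ts_def by blast
  have ch: "children T v = map root ts" by (simp add: children_def ts_def)
  \<comment> \<open>Passing all children of \<open>v\<close> as well ends at the right of its last
    child; without children the end stays where \<open>c\<close> ends.\<close>
  define c' where "c' = right_run ts @ c"
  have plug: "varphi T = plug c' \<langle>\<rangle>"
    using c(1) plug_right_run[of ts "[]"] by (simp add: c'_def plug_append)
  have "distinct (preorder (varphi T))"
    using d by (cases T) (simp add: varphi_def preorder_varphi_forest)
  then have dist: "distinct (map lab c')" using distinct_labs[of c' "\<langle>\<rangle>"] plug by simp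
  then have distR: "distinct (map lab (filter is_right c'))"
    and distL: "distinct (map lab (filter is_left c'))"
    by (simp_all add: distinct_map_filter)
  have distRc: "distinct (map lab (filter is_right c))" using distR by (simp add: c'_def)
  have Lc: "Lc T v = set (map lab (filter is_right c))"
    using c(3) by (simp add: Lc_def p_def)
  have left: "map lab (filter is_left c') = butlast p" using c(2) by (simp add: c'_def)
  have "card (Lc T v) = length (filter is_right c)"
    using distinct_card[OF distRc] unfolding Lc by simp
  then have lsw: "lsw T v = length (filter is_right c')"
    by (simp add: lsw_def ch c'_def)
  have lev: "lev T v = length (filter is_left c')"
    using arg_cong[OF left, of length] by (simp add: lev_def p_def)
  have "p \<noteq> []" using root_path_nonempty[OF p(1)] .
  have "last q = root T" if "root_path T q" for q
    using that by (induction rule: root_path.induct) auto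
  then have set_p: "set p = insert (root T) (set (butlast p))"
    using p(1) \<open>p \<noteq> []\<close> append_butlast_last_id[of p]
    by (metis list.set(2) rotate1.simps(2) set_rotate1)
  \<comment> \<open>The root has no younger siblings and drops out; the other nodes of
    \<open>p\<close> are the labels of the left steps.\<close>
  have "(\<Sum>w\<in>set p. card (younger T w)) = (\<Sum>w\<in>set (butlast p). card (younger T w))"
    by (rule sum.mono_neutral_right) (auto simp: set_p younger_root[OF d])
  also have "\<dots> = (\<Sum>s\<leftarrow>filter is_left c'. card (younger T (lab s)))"
    unfolding left[symmetric] using distL
    by (subst sum_list_distinct_conv_sum_set[symmetric]) (simp_all add: o_def)
  also have "\<dots> = (\<Sum>s\<leftarrow>filter is_left c'. right_spine (off s))"
  proof (intro arg_cong[of _ _ sum_list] map_cong refl)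
    fix s assume "s \<in> set (filter is_left c')"
    then show "card (younger T (lab s)) = right_spine (off s)"
      using subtrees_plug_step[of s c' "\<langle>\<rangle>"] spines_varphi(2)[OF d] plug
      by (metis (no_types, lifting) set_filter mem_Collect_eq)
  qed
  finally have younger: "(\<Sum>w\<in>set p. card (younger T w)) = \<dots>" .
  \<comment> \<open>\<open>c\<close> is empty or begins with the left step at \<open>v\<close>, so
    the first right run of \<open>c'\<close> consists of the children of \<open>v\<close>
    only.\<close>
  have "takeWhile is_right c = []" using c(4) by auto
  then have "takeWhile is_right c' = right_run ts"
    by (simp add: c'_def takeWhile_append)
  then have rsw: "rsw T v = right_width c'"
    using younger by (simp add: rsw_def right_width_def ch p_def)
  have "Lc T v \<union> set (children T v) = set (map lab (filter is_right c'))"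
    unfolding Lc by (auto simp: c'_def ch image_Un)
  then have "(\<Sum>w\<in>Lc T v \<union> set (children T v). lchain T w) =
      (\<Sum>s\<leftarrow>filter is_right c'. lchain T (lab s))"
    using distR by (simp add: sum_list_distinct_conv_sum_set[symmetric] o_def del: set_map)
  also have "\<dots> = (\<Sum>s\<leftarrow>filter is_right c'. left_spine (off s))"
  proof (intro arg_cong[of _ _ sum_list] map_cong refl)
    fix s assume "s \<in> set (filter is_right c')"
    then show "lchain T (lab s) = left_spine (off s)"
      using subtrees_plug_step[of s c' "\<langle>\<rangle>"] spines_varphi(1)[OF d] plug
      by (metis (no_types, lifting) set_filter mem_Collect_eq)
  qed
  finally have elder: "(\<Sum>w\<in>Lc T v \<union> set (children T v). lchain T w) = \<dots>" .
  \<comment> \<open>If \<open>v\<close> is internal, \<open>c'\<close> begins with a right step and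
    both sides are 0.\<close>
  have "length (takeWhile is_left c') = dual_deg T v"
    using c(5) by (simp add: c'_def takeWhile_is_left_right_run dual_deg_def ch lev_def p_def)
  then have drsw: "dual_rsw T v = left_width c'"
    using elder by (simp add: dual_rsw_def left_width_def)
  show thesis
  proof (rule that[OF plug lsw lev rsw drsw])
    show "children T v \<noteq> [] \<longrightarrow> (\<exists>l c''. c' = GoR (last (children T v)) l # c'')"
      using ch by (cases ts rule: rev_cases) (auto simp: c'_def right_run_def)
    show "children T v = [] \<and> v \<noteq> root T \<longrightarrow> (\<exists>r c''. c' = GoL v r # c'')"
      using ch c(4) p(2) by (auto simp: c'_def right_run_def)
  qed
qed

section \<open>Exchange of the statistics by the mirror image\<close>

lemma phi_tilde_phi_tilde: "root T = 0 \<Longrightarrow> phi_tilde (phi_tilde T) = T"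
  by (simp add: phi_tilde_def varphi_varphi_inv varphi_inv_varphi)

text \<open>The added node of \<open>v\<close> is the right child of \<open>u\<close>. Mirrored, it
  is the left child of \<open>u\<close>, hence named after \<open>u\<close>, so the context of
  \<open>u\<close> in \<open>phi_tilde T\<close> is the turned context of \<open>v\<close>.\<close>

lemma statistics_last_child:
  assumes T: "T \<in> plane_trees n" and v: "v \<in> nodes T" and u: "children T v = xs @ [u]"
  shows "(lsw T v, lev T v, rsw T v, dual_rsw T v)
       = (lev (phi_tilde T) u, lsw (phi_tilde T) u, dual_rsw (phi_tilde T) u, rsw (phi_tilde T) u)"
proof -
  let ?T' = "phi_tilde T"
  have d: "distinct (labels T)" "root T = 0" using T by (auto simp: plane_trees_def)
  have d': "distinct (labels ?T')" "root ?T' = 0" "nodes ?T' = nodes T"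
    using T phi_tilde_in_plane_trees[OF T] by (auto simp: plane_trees_def)
  have "u \<noteq> 0" using root_notin_children[OF d(1) v] u d(2) by auto
  obtain c where c: "varphi T = plug c \<langle>\<rangle>"
    "lsw T v = length (filter is_right c)" "lev T v = length (filter is_left c)"
    "rsw T v = right_width c" "dual_rsw T v = left_width c"
    "children T v \<noteq> [] \<longrightarrow> (\<exists>l c'. c = GoR (last (children T v)) l # c')"
    "children T v = [] \<and> v \<noteq> root T \<longrightarrow> (\<exists>r c'. c = GoL v r # c')"
    using statistics_context[OF d(1) v] .
  obtain l k where k: "c = GoR u l # k" using c(6) u by auto
  have c': "varphi ?T' = plug (map turn c) \<langle>\<rangle>"
    by (simp add: varphi_phi_tilde c(1) mirror_plug)
  have sub: "plug (map turn k) \<langle>\<langle>\<rangle>, u, mirror l\<rangle> = varphi ?T'" by (simp add: c' k)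
  have dB: "distinct (preorder (varphi ?T'))"
    using d'(1) by (cases ?T') (simp add: varphi_def preorder_varphi_forest)
  have un: "u \<in> nodes ?T'" using children_in_nodes[OF d(1) v] u d'(3) by simp
  obtain e where e: "varphi ?T' = plug e \<langle>\<rangle>"
    "lsw ?T' u = length (filter is_right e)" "lev ?T' u = length (filter is_left e)"
    "rsw ?T' u = right_width e" "dual_rsw ?T' u = left_width e"
    "children ?T' u \<noteq> [] \<longrightarrow> (\<exists>l c'. e = GoR (last (children ?T' u)) l # c')"
    "children ?T' u = [] \<and> u \<noteq> root ?T' \<longrightarrow> (\<exists>r c'. e = GoL u r # c')"
    using statistics_context[OF d'(1) un] .
  \<comment> \<open>A child of \<open>u\<close> would give \<open>u\<close> a nonempty left subtree,
    yet its left subtree in the mirror image is empty; \<open>lchain\<close> tells the two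
    apart.\<close>
  have "children ?T' u = []"
  proof (rule ccontr)
    assume "children ?T' u \<noteq> []"
    then obtain y where "left_child (varphi ?T') u y"
      using left_child_varphi[OF d'(1)] un d'(2) \<open>u \<noteq> 0\<close>
      by (metis Diff_iff empty_iff insert_iff neq_Nil_conv)
    then obtain a b r where "\<langle>\<langle>a, y, b\<rangle>, u, r\<rangle> \<in> subtrees (varphi ?T')"
      by (auto simp: left_child_def)
    moreover have "\<langle>\<langle>\<rangle>, u, mirror l\<rangle> \<in> subtrees (varphi ?T')"
      using subtrees_plug sub by metis
    ultimately have "left_spine \<langle>a, y, b\<rangle> = left_spine (\<langle>\<rangle> :: nat tree)"
      using spines_varphi(1)[OF d'(1)] by metis
    then show False by simp
  qed
  then obtain r k' where k': "e = GoL u r # k'" using e(7) \<open>u \<noteq> 0\<close> d'(2) by auto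
  \<comment> \<open>Both contexts end at the empty left subtree of the same node
    \<open>u\<close>.\<close>
  have "map turn k = k' \<and> \<langle>\<rangle> = (\<langle>\<rangle> :: nat tree) \<and> mirror l = r"
    by (rule plug_unique[of _ _ u]) (use dB sub e(1) k' in auto)
  then have e_eq: "e = map turn c" by (simp add: k k')
  show ?thesis
    unfolding c(2-5) e(2-5) unfolding e_eq
    by (simp add: left_width_turn right_width_turn filter_map o_def)
qed

theorem theorem2p14:
  fixes n v u :: nat and T :: "nat ptree"
  assumes "n \<ge> 1"
    and "T \<in> plane_trees n"
    and "v \<in> nodes T"
    and "leadsto T v u"
  shows "(lsw T v, lev T v, rsw T v, dual_rsw T v)
       = (lev (phi_tilde T) u, lsw (phi_tilde T) u, dual_rsw (phi_tilde T) u, rsw (phi_tilde T) u)"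
proof -
  let ?T' = "phi_tilde T"
  have T': "?T' \<in> plane_trees n" using phi_tilde_in_plane_trees[OF assms(2)] .
  have d: "distinct (labels T)" "root T = 0" and d': "distinct (labels ?T')"
    using assms(2) T' by (auto simp: plane_trees_def)
  from assms(4) consider xs where "children T v = xs @ [u]"
    | xs where "u \<in> nodes ?T'" "children ?T' u = xs @ [v]"
    unfolding leadsto_def right_child_complement[OF d(1)] right_child_complement[OF d'] by blast
  then show ?thesis
  proof cases
    case 1
    then show ?thesis using statistics_last_child[OF assms(2,3)] by blast
  next
    case 2
    \<comment> \<open>The last-child case for \<open>phi_tilde T\<close> with \<open>u\<close> and
      \<open>v\<close> exchanged; mirroring twice returns to \<open>T\<close>, and the equations are
      read backwards.\<close>
    then show ?thesis
      using statistics_last_child[OF T' 2] phi_tilde_phi_tilde[OF d(2)] by simp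
  qed
qed

end
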